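(* Let $U$ be a Banach Lie group and $G\le U$ a compact subgroup. There is a neighborhood $V\supseteq G$ in $U$ such that every Lie subgroup $K\le U$ contained in $V$ is compact.
   Context: A Banach Lie group is an analytic real Lie group modeled on a (possibly infinite-dimensional) Banach space. A Lie subgroup $K\le U$ is a subgroup that is also an analytic submanifold in the split sense: it is (automatically) closed, and the resulting embedding of tangent spaces $\iota:T_1K\to T_1U$ splits, i.e. there is a continuous linear map $\pi:T_1U\to T_1K$ with $\pi\circ\iota=\mathrm{id}$. *)

theory Defs
  imports "HOL-Analysis.Analysis" "HOL-Algebra.Group"
begin

text \<open>Bounded \<open>n\<close>-linear maps take their arguments as a list of length \<open>n\<close>; on other
  lists their value is irrelevant. \<open>C\<close> is a bound for the operator norm.\<close>

definition bounded_multilinear ::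
    "nat \<Rightarrow> real \<Rightarrow> ('a::real_normed_vector list \<Rightarrow> 'b::real_normed_vector) \<Rightarrow> bool" where
  "bounded_multilinear n C m \<longleftrightarrow>
     (\<forall>xs i. length xs = n \<and> i < n \<longrightarrow> linear (\<lambda>x. m (xs[i := x]))) \<and>
     (\<forall>xs. length xs = n \<longrightarrow> norm (m xs) \<le> C * prod_list (map norm xs))"

text \<open>Real analyticity between Banach spaces: near \<open>x\<close> the map is the sum of a power series
  \<open>\<Sum>n. m n (h, \<dots>, h)\<close> of bounded multilinear maps that converges normally,
  \<open>\<Sum>n. \<parallel>m n\<parallel> r\<^sup>n < \<infinity>\<close>. Only the germ of \<open>f\<close> at \<open>x\<close> matters. Symmetry of \<open>m n\<close> is no
  restriction, since symmetrizing changes neither the values on the diagonal nor the bound.\<close>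

definition banach_analytic_at ::
    "('a::real_normed_vector \<Rightarrow> 'b::real_normed_vector) \<Rightarrow> 'a \<Rightarrow> bool" where
  "banach_analytic_at f x \<longleftrightarrow>
     (\<exists>r m C. r > 0 \<and> (\<forall>n. bounded_multilinear n (C n) (m n)) \<and>
        summable (\<lambda>n. C n * r ^ n) \<and>
        (\<forall>h. norm h < r \<longrightarrow> (\<lambda>n. m n (replicate n h)) sums f (x + h)))"

definition banach_analytic_on ::
    "('a::real_normed_vector \<Rightarrow> 'b::real_normed_vector) \<Rightarrow> 'a set \<Rightarrow> bool" where
  "banach_analytic_on f S \<longleftrightarrow> (\<forall>x\<in>S. banach_analytic_at f x)"

text \<open>A chart is a domain together with a map that is only meaningful on that domain.\<close>

type_synonym ('u, 'e) chart = "'u set \<times> ('u \<Rightarrow> 'e)"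

definition is_chart :: "'u topology \<Rightarrow> ('u, 'e::banach) chart \<Rightarrow> bool" where
  "is_chart T = (\<lambda>(D, \<phi>). openin T D \<and> open (\<phi> ` D) \<and>
     homeomorphic_map (subtopology T D) (top_of_set (\<phi> ` D)) \<phi>)"

definition compatible :: "('u, 'e::banach) chart \<Rightarrow> ('u, 'e) chart \<Rightarrow> bool" where
  "compatible = (\<lambda>(D, \<phi>) (D', \<psi>).
     banach_analytic_on (\<psi> \<circ> inv_into D \<phi>) (\<phi> ` (D \<inter> D')) \<and>
     banach_analytic_on (\<phi> \<circ> inv_into D' \<psi>) (\<psi> ` (D \<inter> D')))"

definition analytic_atlas :: "'u topology \<Rightarrow> ('u, 'e::banach) chart set \<Rightarrow> bool" where
  "analytic_atlas T A \<longleftrightarrow>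
     (\<forall>c\<in>A. is_chart T c) \<and> (\<forall>c\<in>A. \<forall>c'\<in>A. compatible c c') \<and> (\<Union>c\<in>A. fst c) = topspace T"

definition maximal_atlas :: "'u topology \<Rightarrow> ('u, 'e::banach) chart set \<Rightarrow> ('u, 'e) chart set" where
  "maximal_atlas T A = {c. is_chart T c \<and> (\<forall>c'\<in>A. compatible c c')}"

definition prod_atlas ::
    "('u, 'e) chart set \<Rightarrow> ('v, 'f) chart set \<Rightarrow> ('u \<times> 'v, 'e \<times> 'f) chart set" where
  "prod_atlas A B = {(D \<times> D', map_prod \<phi> \<psi>) | D \<phi> D' \<psi>. (D, \<phi>) \<in> A \<and> (D', \<psi>) \<in> B}"

definition analytic_map ::
    "'u topology \<Rightarrow> ('u, 'e::banach) chart set \<Rightarrow> 'v topology \<Rightarrow> ('v, 'f::banach) chart set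
      \<Rightarrow> ('u \<Rightarrow> 'v) \<Rightarrow> bool" where
  "analytic_map S A T B f \<longleftrightarrow> continuous_map S T f \<and>
     (\<forall>(D, \<phi>)\<in>A. \<forall>(D', \<psi>)\<in>B.
        banach_analytic_on (\<psi> \<circ> f \<circ> inv_into D \<phi>) (\<phi> ` {x \<in> D. f x \<in> D'}))"

text \<open>The group \<open>U\<close> has topology \<open>T\<close> and analytic atlas \<open>A\<close> modeled on the Banach space
  \<open>'e\<close>; by homogeneity one model space suffices. The Hausdorff property is not assumed because
  it is automatic: a locally Banach space is \<open>T\<^sub>1\<close>, and a \<open>T\<^sub>1\<close> topological group is Hausdorff.\<close>

locale banach_lie_group = group U
  for U :: "('u, 'm) monoid_scheme" (structure)
  and T :: "'u topology"
  and A :: "('u, 'e::banach) chart set" +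
  assumes topspace_eq: "topspace T = carrier U"
    and atlas: "analytic_atlas T A"
    and analytic_mult:
      "analytic_map (prod_topology T T) (prod_atlas A A) T A (\<lambda>(x, y). x \<otimes> y)"
    and analytic_inv: "analytic_map T A T A (\<lambda>x. inv x)"

text \<open>A chart of the ambient manifold around \<open>p\<close> that straightens \<open>K\<close> to the closed linear
  subspace \<open>F\<close>. In this chart the inclusion of the tangent space of \<open>K\<close> at \<open>p\<close> into that of
  the ambient manifold is the inclusion of \<open>F\<close> into \<open>'e\<close>.\<close>

definition submanifold_chart ::
    "'u topology \<Rightarrow> ('u, 'e::banach) chart set \<Rightarrow> 'u set \<Rightarrow> 'u \<Rightarrow> ('u, 'e) chart \<Rightarrow> 'e set \<Rightarrow> bool"
  where
  "submanifold_chart T A K p c F \<longleftrightarrow>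
     c \<in> maximal_atlas T A \<and> p \<in> fst c \<and> subspace F \<and> closed F \<and>
     snd c ` (fst c \<inter> K) = snd c ` fst c \<inter> F"

definition inclusion_splits :: "'e::real_normed_vector set \<Rightarrow> bool" where
  "inclusion_splits F \<longleftrightarrow> (\<exists>\<pi>. bounded_linear \<pi> \<and> range \<pi> \<subseteq> F \<and> (\<forall>v\<in>F. \<pi> v = v))"

text \<open>Closedness of \<open>K\<close> is a consequence and hence not assumed. By left translation in \<open>K\<close>,
  splitting at the identity implies splitting at every point of \<open>K\<close>.\<close>

definition lie_subgroup ::
    "('u, 'm) monoid_scheme \<Rightarrow> 'u topology \<Rightarrow> ('u, 'e::banach) chart set \<Rightarrow> 'u set \<Rightarrow> bool" where
  "lie_subgroup U T A K \<longleftrightarrow>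
     subgroup K U \<and>
     (\<forall>p\<in>K. \<exists>c F. submanifold_chart T A K p c F) \<and>
     (\<exists>c F. submanifold_chart T A K \<one>\<^bsub>U\<^esub> c F \<and> inclusion_splits F)"

end

theory Submission
  imports Defs "HOL-Library.Ramsey"
begin

text \<open>Near the identity of \<open>U\<close> a chart \<open>\<psi>\<close> turns multiplication into addition up to a small relative
  error (\<open>almost_additive_chart_exists\<close>, from strict differentiability of analytic maps). So in the
  chart the powers of a small element \<open>z\<close> follow the ray through \<open>\<psi> z\<close> until they reach a
  fixed size comparable to the radius \<open>r\<close> of the ball on which this holds.

  Cover the compact group \<open>G\<close> by finitely many left translates of a ball that is small compared
  with \<open>r\<close>, let \<open>V\<close> be their union, and let \<open>K\<close> be a subgroup inside \<open>V\<close>. Every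
  \<open>z \<noteq> 1\<close> in \<open>K\<close> near the identity, however close, has a power of size comparable to \<open>r\<close>, and this power is in \<open>K\<close>, hence in
  one of the finitely many translates. Since the translate determines the power up to an error
  much smaller than \<open>r\<close>, the small elements of \<open>K\<close> point in only finitely many directions,
  approximately. For \<open>x\<close>, \<open>y\<close> in \<open>K\<close> near the identity, the difference \<open>\<psi> y - \<psi> x\<close> has roughly the
  direction of the small element \<open>x\<^sup>-\<^sup>1 y\<close> of \<open>K\<close>. So all differences of points of \<open>K\<close> in the
  chart point in finitely many directions. A bounded set with this property is
  totally bounded: by Ramsey's theorem, an infinite separated subset would contain a sequence that
  moves steadily in one direction
  (\<open>no_bounded_sequence_along_finitely_many_directions\<close>). Since finitely many translates of the
  part of \<open>K\<close> near the identity make up \<open>K\<close>, it follows that \<open>K\<close> is covered by finitely many left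
  translates of any neighbourhood of the identity
  (\<open>sequence_has_close_pair\<close>, \<open>finitely_many_translates_cover\<close>).

  A Lie subgroup is closed near the identity, so this precompactness improves to compactness
  (\<open>locally_closed_subgroup_compact\<close>).\<close>

section \<open>Analytic maps are strictly differentiable\<close>

text \<open>Replacing \<open>k\<close> by \<open>h\<close> in one argument after the other changes the value \<open>n\<close> times, each
  time by the value of \<open>m\<close> on a list that contains \<open>h - k\<close> once.\<close>

lemma multilinear_diagonal_lipschitz:
  assumes M: "bounded_multilinear n C m" and "C \<ge> 0"
    and h: "norm h \<le> R" and k: "norm k \<le> R"
  shows "norm (m (replicate n h) - m (replicate n k)) \<le> C * (real n * R ^ (n - 1) * norm (h - k))"
proof -
  have R: "0 \<le> R" using h norm_ge_zero[of h] by linarith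
  let ?w = "\<lambda>i. replicate i h @ replicate (n - i) k"
  have step: "norm (m (?w (Suc i)) - m (?w i)) \<le> C * (R ^ (n - 1) * norm (h - k))" if i: "i < n" for i
  proof -
    let ?u = "\<lambda>x. replicate i h @ x # replicate (n - Suc i) k"
    have u: "(?w i)[i := x] = ?u x" for x
      using i by (simp add: list_update_append Suc_diff_Suc flip: replicate_Suc)
        (metis Suc_diff_Suc list_update_code(2) replicate_Suc)
    have len: "length (?w i) = n" using i by simp
    have "linear (\<lambda>x. m ((?w i)[i := x]))" using M len i unfolding bounded_multilinear_def by blast
    then have lin: "linear (\<lambda>x. m (?u x))" by (simp only: u)
    have "?w i = ?u k" using i by (metis Suc_diff_Suc replicate_Suc)
    moreover have "?w (Suc i) = ?u h"
      by (metis append.assoc append_Cons append_Nil replicate_Suc replicate_append_same)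
    ultimately have "m (?w (Suc i)) - m (?w i) = m (?u (h - k))"
      using linear_diff[OF lin, of h k] by simp
    moreover have "norm (m (?u (h - k))) \<le> C * prod_list (map norm (?u (h - k)))"
      using M i unfolding bounded_multilinear_def
      by (metis (no_types, lifting) length_append length_list_update length_replicate len u)
    moreover have "prod_list (map norm (?u (h - k))) = norm (h - k) * (norm h ^ i * norm k ^ (n - Suc i))"
      by (simp add: prod_list_replicate)
    moreover have "norm h ^ i * norm k ^ (n - Suc i) \<le> R ^ i * R ^ (n - Suc i)"
      using h k R by (intro mult_mono power_mono) auto
    moreover have "R ^ i * R ^ (n - Suc i) = R ^ (n - 1)" using i by (simp flip: power_add)
    ultimately have "norm (m (?w (Suc i)) - m (?w i)) \<le> C * (norm (h - k) * R ^ (n - 1))"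
      using \<open>C \<ge> 0\<close> by (smt (verit, best) mult_left_mono norm_ge_zero)
    then show ?thesis by (simp add: mult.commute)
  qed
  have "m (replicate n h) - m (replicate n k) = (\<Sum>i<n. m (?w (Suc i)) - m (?w i))"
    by (subst sum_lessThan_telescope) simp
  also have "norm \<dots> \<le> (\<Sum>i<n. C * (R ^ (n - 1) * norm (h - k)))"
    by (rule sum_norm_le) (use step in auto)
  finally show ?thesis by (simp add: algebra_simps)
qed

text \<open>The constant terms cancel, the linear terms give \<open>L\<close>, and by
  the Lipschitz estimate on the ball of radius \<open>d\<close> the terms of degree at least \<open>2\<close> contribute at
  most \<open>\<Sum>n\<ge>2. n C\<^sub>n d\<^bsup>n-1\<^esup> = O(d)\<close> times \<open>\<parallel>h - k\<parallel>\<close>.\<close>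

lemma banach_analytic_at_imp_strictly_differentiable:
  fixes f :: "'a::real_normed_vector \<Rightarrow> 'b::banach"
  assumes "banach_analytic_at f x"
  shows "\<exists>L. linear L \<and> (\<forall>e>0. \<exists>d>0. \<forall>h k. norm h < d \<and> norm k < d \<longrightarrow>
           norm (f (x + h) - f (x + k) - L (h - k)) \<le> e * norm (h - k))"
proof -
  obtain r m C where r: "r > 0" and M: "\<And>n. bounded_multilinear n (C n) (m n)"
    and S: "summable (\<lambda>n. C n * r ^ n)"
    and f: "\<And>h. norm h < r \<Longrightarrow> (\<lambda>n. m n (replicate n h)) sums f (x + h)"
    using assms unfolding banach_analytic_at_def by blast
  define L where "L = (\<lambda>h. m 1 [h])"
  have L: "linear L"
    using M[of 1] unfolding bounded_multilinear_def L_def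
    by (auto dest!: spec[of _ "[0]"])
  show ?thesis
    \<comment> \<open>In the zero space the numbers \<open>C n\<close> with \<open>n > 0\<close> may be negative; any nonzero vector
      forces them to be nonnegative.\<close>
  proof (cases "\<exists>v::'a. v \<noteq> 0")
    case False
    then have "h = k" for h k :: 'a by metis
    then have "norm (f (x + h) - f (x + k) - L (h - k)) \<le> e * norm (h - k)" for h k e
      using linear_0[OF L] by (metis diff_self mult_zero_right norm_zero order_refl)
    then show ?thesis using L zero_less_one by blast
  next
    case True
    then obtain v :: 'a where v: "v \<noteq> 0" by blast
    have C: "C n \<ge> 0" for n
    proof -
      have "norm (m n (replicate n v)) \<le> C n * norm v ^ n"
        using M[of n] unfolding bounded_multilinear_def by (auto simp: prod_list_replicate dest!: spec[of _ "replicate n v"])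
      then have "0 \<le> C n * norm v ^ n" using norm_ge_zero order_trans by blast
      moreover have "0 < norm v ^ n" using v by simp
      ultimately show ?thesis by (auto simp: zero_le_mult_iff)
    qed
    \<comment> \<open>The Lipschitz constants of the terms of degree at least \<open>2\<close> on the ball of radius
      \<open>r / 2\<close>, up to the factor \<open>r / 2\<close>; they are summable because \<open>n \<le> 2\<^sup>n\<close>.\<close>
    define q where "q = (\<lambda>n. real (n + 2) * C (n + 2) * (r / 2) ^ n)"
    have q: "summable q"
    proof (rule summable_comparison_test)
      show "summable (\<lambda>n. 4 / r\<^sup>2 * (C (n + 2) * r ^ (n + 2)))"
        by (intro summable_mult summable_ignore_initial_segment[OF S])
      have "norm (q n) \<le> 4 / r\<^sup>2 * (C (n + 2) * r ^ (n + 2))" for n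
      proof -
        have "real (n + 2) \<le> 4 * 2 ^ n"
          using of_nat_less_two_power[of "n + 2", where 'a = real] by (simp add: power_add)
        then have "real (n + 2) * (C (n + 2) * (r / 2) ^ n) \<le> (4 * 2 ^ n) * (C (n + 2) * (r / 2) ^ n)"
          using C r by (intro mult_right_mono) auto
        also have "\<dots> = 4 / r\<^sup>2 * (C (n + 2) * r ^ (n + 2))"
          using r by (simp add: field_simps power_add power_divide power2_eq_square)
        finally show ?thesis using C r by (simp add: q_def mult.assoc)
      qed
      then show "\<exists>N. \<forall>n\<ge>N. norm (q n) \<le> 4 / r\<^sup>2 * (C (n + 2) * r ^ (n + 2))" by blast
    qed
    have q0: "q n \<ge> 0" for n using C r by (simp add: q_def)
    have bound: "norm (f (x + h) - f (x + k) - L (h - k)) \<le> suminf q * d * norm (h - k)"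
      if d: "0 < d" "d \<le> r / 2" and h: "norm h < d" and k: "norm k < d" for d h k
    proof -
      have "(\<lambda>n. m n (replicate n h) - m n (replicate n k)) sums (f (x + h) - f (x + k))"
        using d h k by (intro sums_diff f) auto
      then have "(\<lambda>n. m (n + 2) (replicate (n + 2) h) - m (n + 2) (replicate (n + 2) k)) sums
         (f (x + h) - f (x + k) - (\<Sum>n<2. m n (replicate n h) - m n (replicate n k)))"
        by (rule sums_split_initial_segment)
      moreover have "(\<Sum>n<2. m n (replicate n h) - m n (replicate n k)) = L (h - k)"
        by (simp add: L_def numeral_2_eq_2 linear_diff[OF L, unfolded L_def, simplified])
      ultimately have s: "(\<lambda>n. m (n + 2) (replicate (n + 2) h) - m (n + 2) (replicate (n + 2) k)) sums
         (f (x + h) - f (x + k) - L (h - k))" by simp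
      have "norm (m (n + 2) (replicate (n + 2) h) - m (n + 2) (replicate (n + 2) k))
          \<le> q n * (d * norm (h - k))" for n
      proof -
        have "norm (m (n + 2) (replicate (n + 2) h) - m (n + 2) (replicate (n + 2) k))
          \<le> C (n + 2) * (real (n + 2) * d ^ (n + 2 - 1) * norm (h - k))"
          using h k by (intro multilinear_diagonal_lipschitz M C) auto
        also have "\<dots> = (real (n + 2) * C (n + 2) * d ^ n) * (d * norm (h - k))" by simp
        also have "\<dots> \<le> q n * (d * norm (h - k))"
          unfolding q_def using C d by (intro mult_right_mono mult_left_mono power_mono) auto
        finally show ?thesis .
      qed
      then have "norm (f (x + h) - f (x + k) - L (h - k)) \<le> (\<Sum>n. q n * (d * norm (h - k)))"
        unfolding sums_unique[OF s] by (intro norm_suminf_le summable_mult2 q)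
      also have "\<dots> = suminf q * d * norm (h - k)" using suminf_mult2[OF q, of "d * norm (h - k)"] by (simp add: mult.assoc)
      finally show ?thesis .
    qed
    show ?thesis
    proof (intro exI[of _ L] conjI L allI impI)
      fix e :: real assume e: "e > 0"
      define Q where "Q = suminf q + 1"
      have Q: "Q > 0" using suminf_nonneg[OF q q0] by (simp add: Q_def)
      define d where "d = min (r / 2) (e / Q)"
      have d: "d > 0" "d \<le> r / 2" using r e Q unfolding d_def by (simp, intro min.cobounded1)
      have "suminf q * d \<le> Q * d" using d by (simp add: Q_def)
      also have "\<dots> \<le> Q * (e / Q)" using Q by (intro mult_left_mono) (auto simp: d_def)
      finally have "suminf q * d \<le> e" using Q by simp
      then have "norm (f (x + h) - f (x + k) - L (h - k)) \<le> e * norm (h - k)" if "norm h < d" "norm k < d" for h k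
        using bound[OF d that] by (meson mult_right_mono norm_ge_zero order_trans)
      then show "\<exists>d>0. \<forall>h k. norm h < d \<and> norm k < d \<longrightarrow>
           norm (f (x + h) - f (x + k) - L (h - k)) \<le> e * norm (h - k)" using d by blast
    qed
  qed
qed

section \<open>Sequences that move in finitely many directions\<close>

text \<open>If every difference \<open>y j - y i\<close> with \<open>i < j\<close> points roughly in one of \<open>M\<close> directions and
  is not too short, then the sequence is unbounded: by Ramsey's theorem some subsequence uses a
  single direction \<open>d\<close>, and then its steps cannot cancel, but add up to vectors that are
  about as long as the sum of their lengths. The colour \<open>col i j\<close> selects the direction, the
  vectors \<open>w i j\<close> represent it up to an error \<open>b\<close>, and \<open>t i j\<close> is the length of the step
  measured in such vectors.\<close>

lemma no_bounded_sequence_along_finitely_many_directions: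
  fixes y :: "nat \<Rightarrow> 'e::real_normed_vector" and w :: "nat \<Rightarrow> nat \<Rightarrow> 'e"
  assumes bdd: "bounded (range y)" and \<eta>: "\<eta> > 0" and abc: "a + b < c"
    and col: "\<And>i j. i < j \<Longrightarrow> col i j < (M::nat)"
    and t: "\<And>i j. i < j \<Longrightarrow> \<eta> \<le> t i j"
    and w: "\<And>i j. i < j \<Longrightarrow> c \<le> norm (w i j)"
    and dir: "\<And>i j. i < j \<Longrightarrow> norm (y j - y i - t i j *\<^sub>R w i j) \<le> t i j * a"
    and same: "\<And>i j i' j'. i < j \<Longrightarrow> i' < j' \<Longrightarrow> col i j = col i' j' \<Longrightarrow> norm (w i j - w i' j') \<le> b"
  shows False
proof -
  define f where "f = (\<lambda>P. col (Min P) (Max P))"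
  have fij: "f {i, j} = col i j" if "i < j" for i j using that by (simp add: f_def)
  have "\<forall>i\<in>UNIV. \<forall>j\<in>UNIV. i \<noteq> j \<longrightarrow> f {i, j} < M"
  proof (intro ballI impI)
    fix i j :: nat assume "i \<noteq> j"
    then show "f {i, j} < M" using fij[of i j] fij[of j i] col[of i j] col[of j i]
      by (cases "i < j") (auto simp: insert_commute)
  qed
  then obtain Y k where Y: "infinite Y" and k: "\<forall>i\<in>Y. \<forall>j\<in>Y. i \<noteq> j \<longrightarrow> f {i, j} = k"
    using Ramsey2[of "UNIV :: nat set" f M] by blast
  let ?i = "enumerate Y"
  have less: "?i p < ?i (Suc p)" for p using enumerate_step[OF Y] .
  have inY: "?i p \<in> Y" for p using enumerate_in_set[OF Y] .
  have colk: "col (?i p) (?i (Suc p)) = k" for p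
    using k inY less[of p] fij[OF less[of p]] by (metis less_irrefl)
  define d where "d = w (?i 0) (?i 1)"
  have d: "c \<le> norm d" unfolding d_def using w less[of 0] by simp
  let ?t = "\<lambda>p. t (?i p) (?i (Suc p))"
  have tpos: "?t p \<ge> \<eta>" for p using t less .
  have step: "norm (y (?i (Suc p)) - y (?i p) - ?t p *\<^sub>R d) \<le> ?t p * (a + b)" for p
  proof -
    have "norm (w (?i p) (?i (Suc p)) - d) \<le> b"
      unfolding d_def using same[OF less[of p] less[of 0]] colk[of p] colk[of 0] by simp
    then have 1: "norm (?t p *\<^sub>R (w (?i p) (?i (Suc p)) - d)) \<le> ?t p * b"
      using tpos[of p] \<eta> by (simp add: mult_left_mono)
    have 2: "y (?i (Suc p)) - y (?i p) - ?t p *\<^sub>R d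
        = (y (?i (Suc p)) - y (?i p) - ?t p *\<^sub>R w (?i p) (?i (Suc p))) + ?t p *\<^sub>R (w (?i p) (?i (Suc p)) - d)"
      by (simp add: algebra_simps)
    show ?thesis
      unfolding 2 distrib_left by (rule norm_triangle_mono[OF dir[OF less[of p]] 1])
  qed
  \<comment> \<open>Each step is \<open>?t p\<close> times a vector at distance at most \<open>a + b\<close> from \<open>d\<close>.\<close>
  have far: "real N * (\<eta> * (c - (a + b))) \<le> norm (y (?i N) - y (?i 0))" for N
  proof -
    let ?s = "\<Sum>p<N. ?t p"
    have "y (?i N) - y (?i 0) - ?s *\<^sub>R d = (\<Sum>p<N. y (?i (Suc p)) - y (?i p) - ?t p *\<^sub>R d)"
      by (simp add: sum_subtractf scaleR_sum_left sum_lessThan_telescope[of "\<lambda>p. y (?i p)", symmetric])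
    also have "norm \<dots> \<le> (\<Sum>p<N. ?t p * (a + b))" by (rule sum_norm_le) (use step in auto)
    also have "\<dots> = ?s * (a + b)" by (simp add: sum_distrib_right)
    finally have 1: "norm (y (?i N) - y (?i 0) - ?s *\<^sub>R d) \<le> ?s * (a + b)" .
    have s: "real N * \<eta> \<le> ?s" using sum_bounded_below[of "{..<N}" \<eta> ?t] tpos by simp
    have s0: "0 \<le> ?s" using order_trans[OF _ s] \<eta> by simp
    have "norm (?s *\<^sub>R d) \<ge> ?s * c" using d s0 by (simp add: mult_left_mono)
    then have "?s * c - ?s * (a + b) \<le> norm (y (?i N) - y (?i 0))"
      using 1 norm_triangle_ineq3[of "?s *\<^sub>R d" "y (?i N) - y (?i 0)"] by (simp add: norm_minus_commute)
    moreover have "real N * \<eta> * (c - (a + b)) \<le> ?s * (c - (a + b))"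
      using s abc by (intro mult_right_mono) auto
    ultimately show ?thesis by (simp add: algebra_simps)
  qed
  obtain b0 where b0: "\<And>i. norm (y i) \<le> b0" using bdd by (auto simp: bounded_iff)
  have "norm (y (?i N) - y (?i 0)) \<le> 2 * b0" for N
    using norm_triangle_ineq4[of "y (?i N)" "y (?i 0)"] b0[of "?i N"] b0[of "?i 0"] by linarith
  then have "real N * (\<eta> * (c - (a + b))) \<le> 2 * b0" for N using far order_trans by blast
  moreover have "\<eta> * (c - (a + b)) > 0" using \<eta> abc by simp
  ultimately show False by (metis not_less reals_Archimedean3)
qed

section \<open>Topological groups with an almost additive chart\<close>

text \<open>The analytic structure enters through a chart centred at the identity in which the product
  \<open>a \<otimes> b\<close> is \<open>\<psi> a + \<psi> b\<close> up to a small multiple of \<open>\<parallel>\<psi> b\<parallel>\<close>. Because the bound involves only the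
  right factor, repeated multiplication by \<open>a\<close> adds nearly \<open>\<psi> a\<close> each time, and \<open>\<psi> y - \<psi> x\<close> is
  nearly \<open>\<psi> (x\<^sup>-\<^sup>1 y)\<close> with a small relative error, however close \<open>x\<close> and \<open>y\<close> are.\<close>

locale almost_additive_chart = group U
  for U :: "('u, 'm) monoid_scheme" (structure) +
  fixes T :: "'u topology" and D :: "'u set" and \<psi> :: "'u \<Rightarrow> 'e::banach" and r :: real
  assumes topspace_eq: "topspace T = carrier U"
    and continuous_mult: "continuous_map (prod_topology T T) T (\<lambda>(x, y). x \<otimes> y)"
    and continuous_inv: "continuous_map T T (\<lambda>x. inv x)"
    and openin_D: "openin T D" and one_in_D: "\<one> \<in> D" and open_image: "open (\<psi> ` D)"
    and homeo: "homeomorphic_map (subtopology T D) (top_of_set (\<psi> ` D)) \<psi>"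
    and psi_one: "\<psi> \<one> = 0" and r_pos: "0 < r"
    and almost_additive: "\<lbrakk>a \<in> D; b \<in> D; norm (\<psi> a) < r; norm (\<psi> b) < r\<rbrakk> \<Longrightarrow>
           a \<otimes> b \<in> D \<and> norm (\<psi> (a \<otimes> b) - \<psi> a - \<psi> b) \<le> norm (\<psi> b) / 8"
begin

definition chart_ball :: "real \<Rightarrow> 'u set" where
  "chart_ball s = {a \<in> D. norm (\<psi> a) < s}"

text \<open>Being closed under inversion, these balls make \<open>inv a \<otimes> b\<close> small for two elements
  \<open>a\<close>, \<open>b\<close> of one ball, so that elements of one left translate are close to each other.\<close>

definition sym_ball :: "real \<Rightarrow> 'u set" where
  "sym_ball s = {a \<in> carrier U. a \<in> chart_ball s \<and> inv a \<in> chart_ball s}"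

lemma D_subset: "D \<subseteq> carrier U"
  using openin_subset[OF openin_D] topspace_eq by simp

lemma chart_ball_subset: "chart_ball s \<subseteq> carrier U"
  using D_subset by (auto simp: chart_ball_def)

lemma inj_psi: "inj_on \<psi> D"
  using homeomorphic_imp_injective_map[OF homeo] D_subset topspace_eq by (simp add: Int_absorb1)

lemma openin_chart_ball: "openin T (chart_ball s)"
proof -
  have "continuous_map (subtopology T D) euclidean \<psi>"
    using homeomorphic_imp_continuous_map[OF homeo] by (simp add: continuous_map_in_subtopology)
  then have "openin (subtopology T D) {x \<in> topspace (subtopology T D). \<psi> x \<in> ball 0 s}"
    by (rule openin_continuous_map_preimage) simp
  moreover have "{x \<in> topspace (subtopology T D). \<psi> x \<in> ball 0 s} = chart_ball s"
    using D_subset topspace_eq by (auto simp: chart_ball_def)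
  ultimately show ?thesis using openin_D by (simp add: openin_open_subtopology)
qed

lemma image_contains_ball:
  assumes "openin T W" and "\<one> \<in> W"
  obtains s where "s > 0" and "ball 0 s \<subseteq> \<psi> ` (D \<inter> W)"
proof -
  have "openin (subtopology T D) (D \<inter> W)"
    using assms openin_D by (simp add: openin_open_subtopology openin_Int)
  then have "openin (top_of_set (\<psi> ` D)) (\<psi> ` (D \<inter> W))"
    using homeomorphic_imp_open_map[OF homeo] by (simp add: open_map_def)
  then have "open (\<psi> ` (D \<inter> W))" using open_image by (simp add: openin_open_eq)
  moreover have "0 \<in> \<psi> ` (D \<inter> W)" using assms one_in_D psi_one by force
  ultimately show ?thesis using that openE by blast
qed

lemma ball_in_image_imp_chart_ball_subset:
  assumes "ball 0 s \<subseteq> \<psi> ` (D \<inter> W)"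
  shows "chart_ball s \<subseteq> W"
proof
  fix a assume a: "a \<in> chart_ball s"
  then have "\<psi> a \<in> \<psi> ` (D \<inter> W)" using assms by (auto simp: chart_ball_def)
  then show "a \<in> W" using a inj_psi by (auto simp: chart_ball_def dest: inj_onD)
qed

lemma continuous_left_mult:
  assumes "g \<in> carrier U"
  shows "continuous_map T T (\<lambda>x. g \<otimes> x)"
proof -
  have "continuous_map T (prod_topology T T) (\<lambda>x. (g, x))"
    using assms topspace_eq by (intro continuous_map_pairedI) auto
  from continuous_map_compose[OF this continuous_mult] show ?thesis by (simp add: o_def)
qed

lemma openin_left_translate:
  assumes "openin T S" and g: "g \<in> carrier U"
  shows "openin T ((\<lambda>x. g \<otimes> x) ` S)"
proof -
  have S: "S \<subseteq> carrier U" using openin_subset[OF assms(1)] topspace_eq by simp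
  have "(\<lambda>x. g \<otimes> x) ` S = {x \<in> topspace T. inv g \<otimes> x \<in> S}"
  proof safe
    fix x assume "x \<in> topspace T" "inv g \<otimes> x \<in> S"
    then show "x \<in> (\<lambda>x. g \<otimes> x) ` S"
      using g topspace_eq by (intro image_eqI[of _ _ "inv g \<otimes> x"]) (auto simp flip: m_assoc)
  qed (use S g topspace_eq in \<open>auto simp flip: m_assoc\<close>)
  then show ?thesis
    using openin_continuous_map_preimage[OF continuous_left_mult assms(1), of "inv g"] g by simp
qed

lemma openin_sym_ball: "openin T (sym_ball s)"
proof -
  have "sym_ball s = chart_ball s \<inter> {x \<in> topspace T. inv x \<in> chart_ball s}" using topspace_eq by (auto simp: sym_ball_def)
  then show ?thesis using openin_continuous_map_preimage[OF continuous_inv openin_chart_ball] openin_chart_ball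
    by (simp add: openin_Int)
qed

lemma one_in_sym_ball: "s > 0 \<Longrightarrow> \<one> \<in> sym_ball s"
  using one_in_D psi_one by (simp add: sym_ball_def chart_ball_def)

lemma norm_psi_mult:
  assumes "a \<in> chart_ball r" and "b \<in> chart_ball r"
  shows "norm (\<psi> (a \<otimes> b) - \<psi> a) \<le> 9 / 8 * norm (\<psi> b)"
proof -
  have "norm (\<psi> (a \<otimes> b) - \<psi> a - \<psi> b) \<le> norm (\<psi> b) / 8"
    using almost_additive assms by (auto simp: chart_ball_def)
  then show ?thesis using norm_triangle_sub[of "\<psi> (a \<otimes> b) - \<psi> a" "\<psi> b"] by simp
qed

lemma sym_ball_quotient:
  assumes a: "a \<in> sym_ball s" and b: "b \<in> sym_ball s"
    and s: "s \<le> r"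
  shows "inv a \<otimes> b \<in> chart_ball (3 * s)"
proof -
  have ia: "inv a \<in> chart_ball r" "norm (\<psi> (inv a)) < s" and b': "b \<in> chart_ball r" "norm (\<psi> b) < s"
    using a b s by (auto simp: sym_ball_def chart_ball_def)
  have "inv a \<otimes> b \<in> D" using almost_additive ia b' by (auto simp: chart_ball_def)
  moreover have "norm (\<psi> (inv a \<otimes> b)) < 3 * s"
    using norm_psi_mult[OF ia(1) b'(1)] norm_triangle_sub[of "\<psi> (inv a \<otimes> b)" "\<psi> (inv a)"] ia(2) b'(2)
      norm_ge_zero[of "\<psi> b"] by linarith
  ultimately show ?thesis by (simp add: chart_ball_def)
qed

lemma translate_sym_ball_quotient:
  assumes g: "g \<in> carrier U" and x: "x \<in> (\<lambda>b. g \<otimes> b) ` sym_ball s"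
    and y: "y \<in> (\<lambda>b. g \<otimes> b) ` sym_ball s"
    and s: "s \<le> r"
  shows "inv x \<otimes> y \<in> chart_ball (3 * s)"
proof -
  obtain a b where a: "a \<in> sym_ball s" "x = g \<otimes> a" and b: "b \<in> sym_ball s" "y = g \<otimes> b" using x y by blast
  have ab: "a \<in> carrier U" "b \<in> carrier U" using a b by (auto simp: sym_ball_def)
  have "inv x \<otimes> y = inv a \<otimes> (inv g \<otimes> (g \<otimes> b))"
    using g ab by (simp add: a(2) b(2) inv_mult_group m_assoc)
  also have "inv g \<otimes> (g \<otimes> b) = b" using g ab by (simp flip: m_assoc)
  finally show ?thesis using sym_ball_quotient[OF a(1) b(1) s] by simp
qed

lemma translate_sym_ball_diff:
  assumes g: "g \<in> carrier U" and x: "x \<in> (\<lambda>b. g \<otimes> b) ` sym_ball s"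
    and y: "y \<in> (\<lambda>b. g \<otimes> b) ` sym_ball s"
    and s: "3 * s \<le> r"
    and xN: "x \<in> chart_ball r"
  shows "norm (\<psi> y - \<psi> x) \<le> 4 * s"
proof -
  have s0: "s > 0" using x unfolding sym_ball_def chart_ball_def by (auto intro: le_less_trans[OF norm_ge_zero])
  have q: "inv x \<otimes> y \<in> chart_ball (3 * s)" using translate_sym_ball_quotient[OF g x y] s s0 by simp
  have "x \<in> carrier U" "y \<in> carrier U" using x y g by (auto simp: sym_ball_def)
  then have "y = x \<otimes> (inv x \<otimes> y)" by (simp flip: m_assoc)
  then show ?thesis using norm_psi_mult[OF xN, of "inv x \<otimes> y"] q s s0 by (auto simp: chart_ball_def)
qed

text \<open>Multiplying once more by \<open>a\<close> adds \<open>\<psi> a\<close> up to an error \<open>\<parallel>\<psi> a\<parallel> / 8\<close>, as long as the powers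
  stay in the chart. Hence \<open>n \<mapsto> a\<^sup>n\<close> follows the ray through \<open>\<psi> a\<close>.\<close>

lemma power_almost_linear:
  assumes a: "a \<in> D" and k: "real k * (9 / 8 * norm (\<psi> a)) < r"
  shows "a [^] k \<in> D \<and> norm (\<psi> (a [^] k) - real k *\<^sub>R \<psi> a) \<le> real k * (norm (\<psi> a) / 8)"
  using k
proof (induction k)
  case 0
  then show ?case using one_in_D psi_one by simp
next
  case (Suc k)
  let ?d = "norm (\<psi> a)"
  have k: "real k * (9 / 8 * ?d) + 9 / 8 * ?d < r" using Suc.prems by (simp add: algebra_simps)
  have nn: "0 \<le> real k * (9 / 8 * ?d)" "0 \<le> ?d" by simp_all
  have IH: "a [^] k \<in> D" "norm (\<psi> (a [^] k) - real k *\<^sub>R \<psi> a) \<le> real k * (?d / 8)"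
    using Suc.IH k nn by linarith+
  have "norm (\<psi> (a [^] k)) \<le> real k * ?d + real k * (?d / 8)"
    using IH(2) norm_triangle_sub[of "\<psi> (a [^] k)" "real k *\<^sub>R \<psi> a"] by simp
  also have "\<dots> = real k * (9 / 8 * ?d)" by simp
  finally have small: "norm (\<psi> (a [^] k)) < r" using k nn by linarith
  have "?d < r" using k nn by linarith
  then have mult: "a [^] k \<otimes> a \<in> D" "norm (\<psi> (a [^] k \<otimes> a) - \<psi> (a [^] k) - \<psi> a) \<le> ?d / 8"
    using almost_additive[OF IH(1) a small] by auto
  have "\<psi> (a [^] Suc k) - real (Suc k) *\<^sub>R \<psi> a
      = (\<psi> (a [^] k \<otimes> a) - \<psi> (a [^] k) - \<psi> a) + (\<psi> (a [^] k) - real k *\<^sub>R \<psi> a)"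
    by (simp add: algebra_simps)
  also have "norm \<dots> \<le> ?d / 8 + real k * (?d / 8)"
    by (rule norm_triangle_mono[OF mult(2) IH(2)])
  finally show ?case using mult(1) by (simp add: algebra_simps)
qed

text \<open>This replaces the exponential map and one-parameter subgroups: the direction of an
  arbitrarily small element is visible at the fixed scale \<open>r\<close> in one of its powers, which lies
  in every subgroup that contains the element.\<close>

lemma power_reaches_scale:
  assumes a: "a \<in> D" and pos: "0 < norm (\<psi> a)" and small: "norm (\<psi> a) \<le> r / 4"
  obtains n :: nat where "n > 0" and "r / 4 \<le> n * norm (\<psi> a)" and "n * norm (\<psi> a) \<le> r / 2"
    and "a [^] n \<in> D" and "norm (\<psi> (a [^] n) - real n *\<^sub>R \<psi> a) \<le> r / 16"
proof -
  let ?d = "norm (\<psi> a)"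
  define n where "n = nat \<lceil>r / 4 / ?d\<rceil>"
  have q: "r / 4 / ?d > 0" using r_pos pos by simp
  have n1: "r / 4 / ?d \<le> n" and n2: "n \<le> r / 4 / ?d + 1" using q unfolding n_def by linarith+
  have lo: "r / 4 \<le> n * ?d" using n1 pos by (simp add: field_simps)
  have "n * ?d \<le> (r / 4 / ?d + 1) * ?d" using n2 by (intro mult_right_mono) auto
  also have "\<dots> = r / 4 + ?d" using pos by (simp add: field_simps)
  finally have hi: "n * ?d \<le> r / 2" using small by simp
  have "n > 0" using n1 q by (metis of_nat_0_less_iff less_le_trans)
  moreover have "real n * (9 / 8 * ?d) < r" using hi r_pos by simp
  from power_almost_linear[OF a this] hi
  have "a [^] n \<in> D" "norm (\<psi> (a [^] n) - real n *\<^sub>R \<psi> a) \<le> r / 16" by auto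
  ultimately show thesis using that lo hi by blast
qed

lemma subgroup_pow_closed:
  assumes "subgroup K U" and "x \<in> K"
  shows "x [^] (n::nat) \<in> K"
  using assms by (induction n) (auto simp: subgroup.one_closed subgroup.m_closed)

text \<open>The heart of the proof. Suppose that all quotients \<open>inv (x i) \<otimes> x j\<close> stay away from the
  identity. Infinitely many \<open>x i\<close> lie in one translate \<open>g c \<otimes> sym_ball (r / 96)\<close>, so a left
  translation moves them to a sequence \<open>y\<close> near the identity. The quotients \<open>z i j\<close> are then small,
  and some power \<open>p i j\<close> of \<open>z i j\<close> has size between \<open>3 r / 16\<close> and \<open>r\<close> and the direction of
  \<open>z i j\<close>, which is roughly that of \<open>\<psi> (y j) - \<psi> (y i)\<close>. But \<open>p i j\<close> belongs to \<open>K\<close>, hence to one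
  of the finitely many small translates, so it takes only finitely many values up to
  an error that is small compared with its size. Thus the bounded sequence \<open>\<psi> (y i)\<close> moves in
  finitely many directions, which is impossible.

  The number \<open>r / 96\<close> is chosen such that the two errors \<open>r / 8\<close> (from the failure of
  additivity) and \<open>r / 24\<close> (a bound for the diameter of a translate in the chart) add up to less than the lower bound \<open>3 r / 16\<close> for
  \<open>\<parallel>\<psi> (p i j)\<parallel>\<close>.\<close>

lemma sequence_has_close_pair:
  assumes K: "subgroup K U"
    and g: "\<And>c. c < M \<Longrightarrow> g c \<in> carrier U"
    and cover: "K \<subseteq> (\<Union>c<(M::nat). (\<lambda>b. g c \<otimes> b) ` sym_ball (r / 96))"
    and x: "\<And>i::nat. x i \<in> K" and \<eta>: "\<eta> > 0"
  shows "\<exists>i j. i < j \<and> inv (x i) \<otimes> x j \<in> chart_ball \<eta>"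
proof (rule ccontr)
  assume "\<not> ?thesis"
  then have far: "inv (x i) \<otimes> x j \<notin> chart_ball \<eta>" if "i < j" for i j using that by blast
  have K': "\<And>a. a \<in> K \<Longrightarrow> a \<in> carrier U" using K by (auto dest: subgroup.subset)
  let ?B = "\<lambda>c. (\<lambda>b. g c \<otimes> b) ` sym_ball (r / 96)"
  have "\<exists>c<M. a \<in> ?B c" if "a \<in> K" for a using cover that by blast
  then obtain c where c: "\<And>a. a \<in> K \<Longrightarrow> c a < M" "\<And>a. a \<in> K \<Longrightarrow> a \<in> ?B (c a)" by metis
  have "finite (range (\<lambda>i. c (x i)))"
    by (rule finite_subset[of _ "{..<M}"]) (use c x in auto)
  from pigeonhole_infinite[OF infinite_UNIV_nat this]
  obtain i0 where I: "infinite {i. c (x i) = c (x i0)}" by auto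
  define e where "e = enumerate {i. c (x i) = c (x i0)}"
  have emono: "e i < e j" if "i < j" for i j unfolding e_def using that I by (rule enumerate_mono)
  have ec: "x (e i) \<in> ?B (c (x i0))" for i
    using enumerate_in_set[OF I, of i] c(2)[OF x, of "e i"] by (simp add: e_def)
  have close: "inv (x (e i)) \<otimes> x (e j) \<in> chart_ball (r / 32)" for i j
    using translate_sym_ball_quotient[OF g[OF c(1)[OF x]] ec ec] r_pos by simp
  define y where "y i = inv (x (e 0)) \<otimes> x (e i)" for i
  define z where "z i j = inv (x (e i)) \<otimes> x (e j)" for i j
  have yN: "y i \<in> chart_ball (r / 32)" for i using close by (simp add: y_def)
  have xc: "x i \<in> carrier U" for i using K' x by blast
  have yz: "y j = y i \<otimes> z i j" for i j
  proof -
    have "x (e i) \<otimes> (inv (x (e i)) \<otimes> x (e j)) = x (e j)" using xc by (simp flip: m_assoc)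
    then show ?thesis using xc by (simp add: y_def z_def m_assoc)
  qed
  have zK: "z i j \<in> K" for i j
    using K x by (simp add: z_def subgroup.m_closed subgroup.m_inv_closed)
  have zD: "z i j \<in> D" and zs: "norm (\<psi> (z i j)) < r / 32" for i j
    using close by (auto simp: z_def chart_ball_def)
  have zl: "\<eta> \<le> norm (\<psi> (z i j))" if "i < j" for i j
    using far[OF emono[OF that]] zD[of i j] by (auto simp: z_def chart_ball_def)
  have "\<exists>n::nat. n > 0 \<and> r / 4 \<le> n * norm (\<psi> (z i j)) \<and> n * norm (\<psi> (z i j)) \<le> r / 2
     \<and> z i j [^] n \<in> D \<and> norm (\<psi> (z i j [^] n) - real n *\<^sub>R \<psi> (z i j)) \<le> r / 16" if "i < j" for i j
  proof -
    have "0 < norm (\<psi> (z i j))" using zl[OF that] \<eta> by linarith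
    moreover have "norm (\<psi> (z i j)) \<le> r / 4" using zs[of i j] r_pos by linarith
    ultimately show ?thesis using power_reaches_scale[OF zD] by metis
  qed
  then obtain n :: "nat \<Rightarrow> nat \<Rightarrow> nat" where n: "\<And>i j. i < j \<Longrightarrow> n i j > 0"
      "\<And>i j. i < j \<Longrightarrow> r / 4 \<le> n i j * norm (\<psi> (z i j))"
      "\<And>i j. i < j \<Longrightarrow> n i j * norm (\<psi> (z i j)) \<le> r / 2"
      "\<And>i j. i < j \<Longrightarrow> z i j [^] n i j \<in> D"
      "\<And>i j. i < j \<Longrightarrow> norm (\<psi> (z i j [^] n i j) - real (n i j) *\<^sub>R \<psi> (z i j)) \<le> r / 16"
    by metis
  define p where "p i j = z i j [^] n i j" for i j
  have pK: "p i j \<in> K" for i j unfolding p_def using subgroup_pow_closed[OF K zK] .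
  have pdiff: "norm (\<psi> (p i j) - real (n i j) *\<^sub>R \<psi> (z i j)) \<le> r / 16" if "i < j" for i j
    using n(5)[OF that] by (simp add: p_def)
  have plow: "3 * r / 16 \<le> norm (\<psi> (p i j))" and phigh: "norm (\<psi> (p i j)) < r" if "i < j" for i j
    using pdiff[OF that] n(2,3)[OF that] r_pos
      norm_triangle_ineq3[of "\<psi> (p i j)" "real (n i j) *\<^sub>R \<psi> (z i j)"] by auto
  have pN: "p i j \<in> chart_ball r" if "i < j" for i j
    using phigh[OF that] n(4)[OF that] by (simp add: chart_ball_def p_def)
  show False
  proof (rule no_bounded_sequence_along_finitely_many_directions
      [of "\<lambda>i. \<psi> (y i)" "2 * \<eta> / r" "r / 8" "r / 24" "3 * r / 16" "\<lambda>i j. c (p i j)" M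
        "\<lambda>i j. 1 / n i j" "\<lambda>i j. \<psi> (p i j)"])
    show "bounded (range (\<lambda>i. \<psi> (y i)))"
      using yN by (auto simp: bounded_iff chart_ball_def intro!: exI[of _ "r / 32"] less_imp_le)
    show "0 < 2 * \<eta> / r" "r / 8 + r / 24 < 3 * r / 16" using r_pos \<eta> by auto
    fix i j :: nat assume ij: "i < j"
    show "c (p i j) < M" using c pK by blast
    have "n i j * \<eta> \<le> r / 2"
      using n(3)[OF ij] zl[OF ij] by (meson mult_left_mono of_nat_0_le_iff order_trans)
    then show "2 * \<eta> / r \<le> 1 / n i j" using n(1)[OF ij] r_pos by (simp add: field_simps)
    show "3 * r / 16 \<le> norm (\<psi> (p i j))" using plow[OF ij] .
    let ?n = "real (n i j)"
    have npos: "?n > 0" using n(1)[OF ij] by simp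
    have "y i \<in> D" "norm (\<psi> (y i)) < r" "norm (\<psi> (z i j)) < r"
      using yN[of i] zs[of i j] r_pos by (auto simp: chart_ball_def)
    then have 1: "norm (\<psi> (y j) - \<psi> (y i) - \<psi> (z i j)) \<le> norm (\<psi> (z i j)) / 8"
      using almost_additive zD yz[of j i] by simp
    have "norm (?n *\<^sub>R (\<psi> (y j) - \<psi> (y i) - \<psi> (z i j))) \<le> ?n * (norm (\<psi> (z i j)) / 8)"
      using mult_left_mono[OF 1, of ?n] by simp
    also have "\<dots> \<le> r / 16" using n(3)[OF ij] by simp
    finally have 2: "norm (?n *\<^sub>R (\<psi> (y j) - \<psi> (y i) - \<psi> (z i j))) \<le> r / 16" .
    have 3: "\<psi> (y j) - \<psi> (y i) - (1 / ?n) *\<^sub>R \<psi> (p i j) = (1 / ?n) *\<^sub>R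
       (?n *\<^sub>R (\<psi> (y j) - \<psi> (y i) - \<psi> (z i j)) - (\<psi> (p i j) - ?n *\<^sub>R \<psi> (z i j)))"
      using npos by (simp add: algebra_simps)
    have "norm (?n *\<^sub>R (\<psi> (y j) - \<psi> (y i) - \<psi> (z i j)) - (\<psi> (p i j) - ?n *\<^sub>R \<psi> (z i j))) \<le> r / 8"
      using norm_triangle_le_diff[OF add_mono[OF 2 pdiff[OF ij]]] by simp
    then show "norm (\<psi> (y j) - \<psi> (y i) - (1 / ?n) *\<^sub>R \<psi> (p i j)) \<le> 1 / ?n * (r / 8)"
      unfolding 3 norm_scaleR using npos by (simp only: abs_of_pos zero_less_divide_1_iff mult_left_mono less_imp_le)
    fix i' j' :: nat assume ij': "i' < j'" and same: "c (p i j) = c (p i' j')"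
    have "p i j \<in> ?B (c (p i' j'))" using c(2)[OF pK, of i j] same by simp
    then have "norm (\<psi> (p i j) - \<psi> (p i' j')) \<le> 4 * (r / 96)"
      using translate_sym_ball_diff[OF g[OF c(1)[OF pK]] c(2)[OF pK] _ _ pN[OF ij']] r_pos by simp
    then show "norm (\<psi> (p i j) - \<psi> (p i' j')) \<le> r / 24" by simp
  qed
qed

text \<open>The covering hypothesis concerns a single scale, the conclusion all
  scales: a subgroup that is bounded at scale \<open>r\<close> in this sense is precompact. Otherwise, a greedy
  choice would produce a sequence without close pairs.\<close>

lemma finitely_many_translates_cover:
  assumes K: "subgroup K U"
    and g: "\<And>c. c < M \<Longrightarrow> g c \<in> carrier U"
    and cover: "K \<subseteq> (\<Union>c<(M::nat). (\<lambda>b. g c \<otimes> b) ` sym_ball (r / 96))"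
    and W: "openin T W" "\<one> \<in> W"
  obtains F where "finite F" and "F \<subseteq> K" and "K \<subseteq> (\<Union>x\<in>F. (\<lambda>b. x \<otimes> b) ` W)"
proof -
  obtain s where s: "s > 0" "chart_ball s \<subseteq> W"
    using image_contains_ball[OF W] ball_in_image_imp_chart_ball_subset by metis
  have "\<exists>F. finite F \<and> F \<subseteq> K \<and> K \<subseteq> (\<Union>x\<in>F. (\<lambda>b. x \<otimes> b) ` W)"
  proof (rule ccontr)
    assume no: "\<not> ?thesis"
    have "\<exists>x::nat \<Rightarrow> 'u. \<forall>n. x n \<in> K \<and> (\<forall>i<n. x n \<notin> (\<lambda>b. x i \<otimes> b) ` W)"
    proof (rule dependent_wellorder_choice)
      fix n and x :: "nat \<Rightarrow> 'u"
      assume "\<And>i. i < n \<Longrightarrow> x i \<in> K \<and> (\<forall>k<i. x i \<notin> (\<lambda>b. x k \<otimes> b) ` W)"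
      then have "finite (x ` {..<n})" "x ` {..<n} \<subseteq> K" by auto
      then have "\<not> K \<subseteq> (\<Union>a\<in>x ` {..<n}. (\<lambda>b. a \<otimes> b) ` W)" using no by blast
      then obtain a where "a \<in> K" "a \<notin> (\<Union>a\<in>x ` {..<n}. (\<lambda>b. a \<otimes> b) ` W)" by blast
      then show "\<exists>a. a \<in> K \<and> (\<forall>i<n. a \<notin> (\<lambda>b. x i \<otimes> b) ` W)" by blast
    qed auto
    then obtain x :: "nat \<Rightarrow> 'u" where x: "\<And>n. x n \<in> K"
      and far: "\<And>i j. i < j \<Longrightarrow> x j \<notin> (\<lambda>b. x i \<otimes> b) ` W" by blast
    obtain i j where ij: "i < j" "inv (x i) \<otimes> x j \<in> chart_ball s"
      using sequence_has_close_pair[OF K g cover x s(1)] by blast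
    have "x i \<in> carrier U" "x j \<in> carrier U" using x K by (auto dest: subgroup.subset)
    then have "x j = x i \<otimes> (inv (x i) \<otimes> x j)" by (simp flip: m_assoc)
    then show False using far[OF ij(1)] ij(2) s(2) by blast
  qed
  then show thesis using that by blast
qed

text \<open>Precompactness becomes compactness at the identity: near there the image of \<open>K\<close> in the chart
  is closed in a Banach space, hence complete, and it is totally bounded because points of one
  translate of a small ball are close to each other in the chart. Finitely many translates of
  this compact piece \<open>C\<close> cover \<open>K\<close>.\<close>

lemma locally_closed_subgroup_compact:
  assumes K: "subgroup K U"
    and g: "\<And>c. c < M \<Longrightarrow> g c \<in> carrier U"
    and cover: "K \<subseteq> (\<Union>c<(M::nat). (\<lambda>b. g c \<otimes> b) ` sym_ball (r / 96))"
    and W: "openin T W" "\<one> \<in> W" and closed: "closedin (subtopology T W) (W \<inter> K)"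
  shows "compactin T K"
proof -
  have K': "K \<subseteq> carrier U" using K by (rule subgroup.subset)
  obtain s where s: "s > 0" "ball 0 s \<subseteq> \<psi> ` (D \<inter> W)" using image_contains_ball[OF W] .
  define t where "t = min (s / 2) (r / 2)"
  have t: "0 < t" "t < s" "t < r" using s(1) r_pos by (auto simp: t_def)
  define C where "C = {a \<in> D \<inter> K. norm (\<psi> a) \<le> t}"
  obtain Z0 where Z0: "closedin T Z0" "W \<inter> K = Z0 \<inter> W"
    using closed by (auto simp: closedin_subtopology)
  have "closedin (subtopology T D) (Z0 \<inter> D)" using Z0(1) by (auto simp: closedin_subtopology)
  then have "closedin (top_of_set (\<psi> ` D)) (\<psi> ` (Z0 \<inter> D))"
    using homeomorphic_imp_closed_map[OF homeo] by (simp add: closed_map_def)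
  then obtain Z where Z: "closed Z" "\<psi> ` (Z0 \<inter> D) = \<psi> ` D \<inter> Z"
    by (auto simp: closedin_closed)
  have "\<psi> ` C = cball 0 t \<inter> Z"
  proof (intro equalityI subsetI)
    fix v assume "v \<in> \<psi> ` C"
    then obtain a where a: "a \<in> D" "a \<in> K" "norm (\<psi> a) \<le> t" "v = \<psi> a" by (auto simp: C_def)
    then have "a \<in> chart_ball s" using t by (simp add: chart_ball_def)
    then have "a \<in> W" using ball_in_image_imp_chart_ball_subset[OF s(2)] by blast
    then have "a \<in> Z0" using Z0(2) a by blast
    then show "v \<in> cball 0 t \<inter> Z" using a Z(2) by auto
  next
    fix v assume v: "v \<in> cball 0 t \<inter> Z"
    then have "v \<in> ball 0 s" using t by auto
    then obtain a where a: "a \<in> D" "a \<in> W" "v = \<psi> a" using s(2) by blast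
    then have "v \<in> \<psi> ` (Z0 \<inter> D)" using v Z(2) by blast
    then have "a \<in> Z0" using a inj_psi by (auto dest: inj_onD)
    then have "a \<in> K" using Z0(2) a by blast
    then show "v \<in> \<psi> ` C" using a v by (auto simp: C_def)
  qed
  then have complete: "complete (\<psi> ` C)" using Z(1) by (simp add: complete_eq_closed closed_Int)
  have "\<exists>k. finite k \<and> \<psi> ` C \<subseteq> (\<Union>v\<in>k. ball v \<epsilon>)" if \<epsilon>: "\<epsilon> > 0" for \<epsilon>
  proof -
    define \<sigma> where "\<sigma> = min (r / 3) (\<epsilon> / 8)"
    have \<sigma>: "\<sigma> > 0" "3 * \<sigma> \<le> r" "4 * \<sigma> < \<epsilon>" using r_pos \<epsilon> by (auto simp: \<sigma>_def)
    obtain F where F: "finite F" "F \<subseteq> K" "K \<subseteq> (\<Union>x\<in>F. (\<lambda>b. x \<otimes> b) ` sym_ball \<sigma>)"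
      using finitely_many_translates_cover[OF K g cover openin_sym_ball one_in_sym_ball[OF \<sigma>(1)]] .
    \<comment> \<open>The centres are chosen in \<open>C\<close>, because the translating element \<open>x\<close> itself may lie outside
      the chart. Where a translate misses \<open>C\<close>, the value of \<open>q\<close> is irrelevant.\<close>
    define q where "q x = (SOME a. a \<in> C \<inter> (\<lambda>b. x \<otimes> b) ` sym_ball \<sigma>)" for x
    have "\<psi> a \<in> (\<Union>v\<in>(\<lambda>x. \<psi> (q x)) ` F. ball v \<epsilon>)" if a: "a \<in> C" for a
    proof -
      obtain x where x: "x \<in> F" "a \<in> (\<lambda>b. x \<otimes> b) ` sym_ball \<sigma>" using F(3) a by (auto simp: C_def)
      have q: "q x \<in> C \<inter> (\<lambda>b. x \<otimes> b) ` sym_ball \<sigma>" 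
        unfolding q_def by (rule someI[where x = a]) (use a x(2) in blast)
      have "norm (\<psi> a - \<psi> (q x)) \<le> 4 * \<sigma>"
        using q x F(2) K' \<sigma>(2) t by (intro translate_sym_ball_diff[of x]) (auto simp: C_def chart_ball_def)
      then have "\<psi> a \<in> ball (\<psi> (q x)) \<epsilon>"
        using \<sigma>(3) by (simp add: dist_norm norm_minus_commute)
      then show ?thesis using x(1) by blast
    qed
    then show ?thesis using F(1) by (intro exI[of _ "(\<lambda>x. \<psi> (q x)) ` F"]) auto
  qed
  then have "compact (\<psi> ` C)" using complete by (simp add: compact_eq_totally_bounded)
  moreover have "C \<subseteq> D" by (auto simp: C_def)
  ultimately have "compactin (subtopology T D) C"
    using homeomorphic_map_compactness_eq[OF homeo, of C] D_subset topspace_eq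
    by (auto simp: compactin_subtopology)
  then have C: "compactin T C" by (simp add: compactin_subtopology)
  have "\<one> \<in> chart_ball t" using one_in_D psi_one t by (simp add: chart_ball_def)
  then obtain F where F: "finite F" "F \<subseteq> K" "K \<subseteq> (\<Union>x\<in>F. (\<lambda>b. x \<otimes> b) ` chart_ball t)"
    using finitely_many_translates_cover[OF K g cover openin_chart_ball] by blast
  have "K = (\<Union>x\<in>F. (\<lambda>b. x \<otimes> b) ` C)"
  proof (intro equalityI subsetI)
    fix a assume a: "a \<in> K"
    then obtain x b where x: "x \<in> F" "b \<in> chart_ball t" "a = x \<otimes> b" using F(3) by blast
    have xb: "x \<in> carrier U" "b \<in> carrier U" "x \<in> K" using x F(2) K' chart_ball_subset by auto
    then have "b = inv x \<otimes> a" by (simp add: x(3) flip: m_assoc)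
    then have "b \<in> K" using K xb a by (simp add: subgroup.m_closed subgroup.m_inv_closed)
    then show "a \<in> (\<Union>x\<in>F. (\<lambda>b. x \<otimes> b) ` C)" using x by (force simp: C_def chart_ball_def)
  next
    fix a assume "a \<in> (\<Union>x\<in>F. (\<lambda>b. x \<otimes> b) ` C)"
    then show "a \<in> K" using F(2) K by (auto simp: C_def subgroup.m_closed)
  qed
  moreover have "compactin T (\<Union>x\<in>F. (\<lambda>b. x \<otimes> b) ` C)"
    using F(1,2) K' C by (intro compactin_Union) (auto intro!: image_compactin[OF _ continuous_left_mult])
  ultimately show ?thesis by simp
qed

end

section \<open>Banach Lie groups and their Lie subgroups\<close>

context banach_lie_group
begin

lemma continuous_mult: "continuous_map (prod_topology T T) T (\<lambda>(x, y). x \<otimes> y)"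
  using analytic_mult by (simp add: analytic_map_def)

text \<open>Let \<open>L\<close> be the derivative of the multiplication at the identity in a chart.
  Strict differentiability compares \<open>a \<otimes> b\<close> with \<open>a \<otimes> \<one>\<close> and also \<open>\<one> \<otimes> b\<close> with \<open>\<one> \<otimes> \<one>\<close>. Both
  comparisons involve the same vector \<open>L (0, \<psi> b)\<close>, so it cancels and leaves an error of
  \<open>2 / 16\<close> times \<open>\<parallel>\<psi> b\<parallel>\<close>.\<close>

lemma almost_additive_chart_exists: "\<exists>D (\<psi> :: 'u \<Rightarrow> 'e) r. almost_additive_chart U T D \<psi> r"
proof -
  have "\<one> \<in> (\<Union>c\<in>A. fst c)" using atlas topspace_eq by (simp add: analytic_atlas_def)
  then obtain D \<phi> where A: "(D, \<phi>) \<in> A" and one: "\<one> \<in> D" by force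
  have "is_chart T (D, \<phi>)" using atlas A by (auto simp: analytic_atlas_def)
  then have D: "openin T D" and im: "open (\<phi> ` D)"
    and hom: "homeomorphic_map (subtopology T D) (top_of_set (\<phi> ` D)) \<phi>"
    by (auto simp: is_chart_def)
  have Dsub: "D \<subseteq> carrier U" using openin_subset[OF D] topspace_eq by simp
  have inj: "inj_on \<phi> D"
    using homeomorphic_imp_injective_map[OF hom] Dsub topspace_eq by (simp add: Int_absorb1)
  define p where "p = \<phi> \<one>"
  define \<psi> where "\<psi> a = \<phi> a - p" for a
  define f where "f = \<phi> \<circ> (\<lambda>(x, y). x \<otimes> y) \<circ> inv_into (D \<times> D) (map_prod \<phi> \<phi>)"
  have f: "f (\<phi> a, \<phi> b) = \<phi> (a \<otimes> b)" if "a \<in> D" "b \<in> D" for a b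
  proof -
    have "inv_into (D \<times> D) (map_prod \<phi> \<phi>) (map_prod \<phi> \<phi> (a, b)) = (a, b)"
      using that map_prod_inj_on[OF inj inj] by (intro inv_into_f_f) auto
    then show ?thesis by (simp add: f_def)
  qed
  have "(D \<times> D, map_prod \<phi> \<phi>) \<in> prod_atlas A A" using A by (auto simp: prod_atlas_def)
  then have "banach_analytic_on f (map_prod \<phi> \<phi> ` {x \<in> D \<times> D. (\<lambda>(x, y). x \<otimes> y) x \<in> D})"
    using analytic_mult A unfolding analytic_map_def f_def by blast
  moreover have "(p, p) \<in> map_prod \<phi> \<phi> ` {x \<in> D \<times> D. (\<lambda>(x, y). x \<otimes> y) x \<in> D}"
    using one by (intro image_eqI[of _ _ "(\<one>, \<one>)"]) (auto simp: p_def)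
  ultimately have ana: "banach_analytic_at f (p, p)" unfolding banach_analytic_on_def by (rule bspec)
  from banach_analytic_at_imp_strictly_differentiable[OF ana]
  obtain L where L: "linear L \<and> (\<forall>e>0. \<exists>d>0. \<forall>h k. norm h < d \<and> norm k < d \<longrightarrow>
           norm (f ((p, p) + h) - f ((p, p) + k) - L (h - k)) \<le> e * norm (h - k))" ..
  have "\<exists>d>0. \<forall>h k. norm h < d \<and> norm k < d \<longrightarrow>
           norm (f ((p, p) + h) - f ((p, p) + k) - L (h - k)) \<le> 1 / 16 * norm (h - k)"
    by (rule mp[OF spec[OF conjunct2[OF L]]]) simp
  then obtain d where d: "d > 0" and Ld: "\<And>h k. norm h < d \<Longrightarrow> norm k < d \<Longrightarrow>
           norm (f ((p, p) + h) - f ((p, p) + k) - L (h - k)) \<le> 1 / 16 * norm (h - k)"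
    by auto
  have estimate: "norm (\<psi> (a \<otimes> b) - \<psi> a - \<psi> b) \<le> norm (\<psi> b) / 8"
    if a: "a \<in> D" "norm (\<psi> a) < d / 2" and b: "b \<in> D" "norm (\<psi> b) < d / 2" for a b
  proof -
    have "norm (\<psi> a, \<psi> b) < d" "norm (\<psi> a, 0 :: 'e) < d" "norm (0 :: 'e, \<psi> b) < d" "norm (0 :: 'e, 0 :: 'e) < d"
      using norm_Pair_le[of "\<psi> a" "\<psi> b"] a b d by (auto simp: norm_Pair)
    moreover have "(p, p) + (\<psi> a, \<psi> b) = (\<phi> a, \<phi> b)" "(p, p) + (\<psi> a, 0) = (\<phi> a, \<phi> \<one>)"
      "(p, p) + (0, \<psi> b) = (\<phi> \<one>, \<phi> b)" "(p, p) + (0, 0) = (\<phi> \<one>, \<phi> \<one>)"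
      by (auto simp: \<psi>_def p_def)
    ultimately have "norm (\<phi> (a \<otimes> b) - \<phi> a - L (0, \<psi> b)) \<le> 1 / 16 * norm (\<psi> b)"
      and "norm (\<phi> b - p - L (0, \<psi> b)) \<le> 1 / 16 * norm (\<psi> b)"
      using Ld[of "(\<psi> a, \<psi> b)" "(\<psi> a, 0)"] Ld[of "(0, \<psi> b)" "(0, 0)"] a(1) b(1) one f Dsub
      by (auto simp: norm_Pair p_def)
    from norm_triangle_le_diff[OF add_mono[OF this]] show ?thesis by (simp add: \<psi>_def algebra_simps)
  qed
  have "openin (prod_topology T T) {x \<in> topspace (prod_topology T T). (\<lambda>(x, y). x \<otimes> y) x \<in> D}"
    by (rule openin_continuous_map_preimage[OF continuous_mult D])
  moreover have "(\<one>, \<one>) \<in> {x \<in> topspace (prod_topology T T). (\<lambda>(x, y). x \<otimes> y) x \<in> D}"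
    using one topspace_eq by auto
  ultimately obtain P Q where P: "openin T P" "\<one> \<in> P" and Q: "openin T Q" "\<one> \<in> Q"
    and PQ: "P \<times> Q \<subseteq> {x \<in> topspace (prod_topology T T). (\<lambda>(x, y). x \<otimes> y) x \<in> D}"
    unfolding openin_prod_topology_alt by blast
  have "openin (subtopology T D) (D \<inter> (P \<inter> Q))"
    using P Q D by (simp add: openin_open_subtopology openin_Int)
  then have "openin (top_of_set (\<phi> ` D)) (\<phi> ` (D \<inter> (P \<inter> Q)))"
    using homeomorphic_imp_open_map[OF hom] by (simp add: open_map_def)
  then have "open (\<phi> ` (D \<inter> (P \<inter> Q)))" using im by (simp add: openin_open_eq)
  moreover have "p \<in> \<phi> ` (D \<inter> (P \<inter> Q))" using P Q one by (auto simp: p_def)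
  ultimately obtain s where s: "s > 0" "ball p s \<subseteq> \<phi> ` (D \<inter> (P \<inter> Q))" using openE by blast
  have PQs: "a \<in> P \<inter> Q" if "a \<in> D" "norm (\<psi> a) < s" for a
  proof -
    have "\<phi> a \<in> ball p s" using that by (simp add: \<psi>_def dist_norm norm_minus_commute)
    then show ?thesis using s(2) that(1) inj by (auto dest: inj_onD)
  qed
  have img: "\<psi> ` D = (\<lambda>v. v - p) ` \<phi> ` D" by (simp add: \<psi>_def image_image)
  have "homeomorphic_maps (top_of_set (\<phi> ` D)) (top_of_set (\<psi> ` D)) (\<lambda>v. v - p) (\<lambda>v. v + p)"
    unfolding homeomorphic_maps_def
    by (auto simp: img continuous_map_in_subtopology intro!: continuous_intros)
  then have "homeomorphic_map (top_of_set (\<phi> ` D)) (top_of_set (\<psi> ` D)) (\<lambda>v. v - p)"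
    using homeomorphic_map_maps by blast
  from homeomorphic_map_compose[OF hom this]
  have homeo: "homeomorphic_map (subtopology T D) (top_of_set (\<psi> ` D)) \<psi>"
    by (simp add: o_def \<psi>_def[abs_def])
  have "almost_additive_chart U T D \<psi> (min s (d / 2))"
  proof
    show "topspace T = carrier U" by (rule topspace_eq)
    show "continuous_map (prod_topology T T) T (\<lambda>(x, y). x \<otimes> y)" by (rule continuous_mult)
    show "continuous_map T T (\<lambda>x. inv x)" using analytic_inv by (simp add: analytic_map_def)
    show "openin T D" "\<one> \<in> D" by fact+
    show "open (\<psi> ` D)" unfolding img using open_translation_subtract[OF im, of p] by simp
    show "homeomorphic_map (subtopology T D) (top_of_set (\<psi> ` D)) \<psi>" by fact
    show "\<psi> \<one> = 0" by (simp add: \<psi>_def p_def)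
    show "0 < min s (d / 2)" using s d by simp
    fix a b assume ab: "a \<in> D" "b \<in> D" "norm (\<psi> a) < min s (d / 2)" "norm (\<psi> b) < min s (d / 2)"
    then have "(a, b) \<in> P \<times> Q" using PQs by auto
    then have "a \<otimes> b \<in> D" using PQ by auto
    then show "a \<otimes> b \<in> D \<and> norm (\<psi> (a \<otimes> b) - \<psi> a - \<psi> b) \<le> norm (\<psi> b) / 8"
      using estimate ab by simp
  qed
  then show ?thesis by blast
qed

end

text \<open>In a submanifold chart at the identity, \<open>K\<close> is the preimage of a closed linear subspace.\<close>

lemma lie_subgroup_locally_closed:
  assumes "lie_subgroup U T A K"
  obtains W where "openin T W" and "\<one>\<^bsub>U\<^esub> \<in> W" and "closedin (subtopology T W) (W \<inter> K)"
proof -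
  obtain W \<phi> F where c: "submanifold_chart T A K \<one>\<^bsub>U\<^esub> (W, \<phi>) F"
    using assms unfolding lie_subgroup_def by (metis prod.collapse)
  then have W: "openin T W" "\<one>\<^bsub>U\<^esub> \<in> W" and F: "closed F" "\<phi> ` (W \<inter> K) = \<phi> ` W \<inter> F"
    and hom: "homeomorphic_map (subtopology T W) (top_of_set (\<phi> ` W)) \<phi>"
    by (auto simp: submanifold_chart_def maximal_atlas_def is_chart_def)
  have "closedin (top_of_set (\<phi> ` W)) (\<phi> ` (W \<inter> K))" using F by (auto simp: closedin_closed)
  then have "closedin (subtopology T W) (W \<inter> K)"
    using homeomorphic_map_closedness_eq[OF hom, of "W \<inter> K"] openin_subset[OF W(1)]
    by auto
  then show thesis using that W by blast
qed

text \<open>The neighbourhood \<open>V\<close> is a union of finitely many left translates of the fixed small ball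
  \<open>sym_ball (r / 96)\<close>, which exists because \<open>G\<close> is compact.\<close>

theorem theorem5p1:
  fixes U :: "('u, 'm) monoid_scheme"
    and T :: "'u topology"
    and A :: "('u, 'e::banach) chart set"
    and G :: "'u set"
  assumes "banach_lie_group U T A"
    and "subgroup G U"
    and "compactin T G"
  shows "\<exists>V W. openin T W \<and> G \<subseteq> W \<and> W \<subseteq> V \<and> V \<subseteq> carrier U \<and>
           (\<forall>K. lie_subgroup U T A K \<and> K \<subseteq> V \<longrightarrow> compactin T K)"
proof -
  obtain D and \<psi> :: "'u \<Rightarrow> 'e" and r where "almost_additive_chart U T D \<psi> r"
    using banach_lie_group.almost_additive_chart_exists[OF assms(1)] by blast
  then interpret almost_additive_chart U T D \<psi> r .
  let ?B = "\<lambda>g. (\<lambda>b. g \<otimes>\<^bsub>U\<^esub> b) ` sym_ball (r / 96)"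
  have G: "G \<subseteq> carrier U" using assms(2) by (rule subgroup.subset)
  have opn: "openin T (?B g)" if "g \<in> G" for g
    using openin_left_translate[OF openin_sym_ball] G that by blast
  have "G \<subseteq> (\<Union>g\<in>G. ?B g)"
  proof
    fix g assume g: "g \<in> G"
    have "g \<in> ?B g"
      using G g one_in_sym_ball[of "r / 96"] r_pos by (intro image_eqI[of _ _ "\<one>\<^bsub>U\<^esub>"]) auto
    then show "g \<in> (\<Union>g\<in>G. ?B g)" using g by (rule UN_I[rotated])
  qed
  moreover have "\<forall>X\<in>?B ` G. openin T X" using opn by blast
  ultimately obtain \<F> where "finite \<F>" "\<F> \<subseteq> ?B ` G" "G \<subseteq> \<Union>\<F>"
    using assms(3) unfolding compactin_def by meson
  then obtain S where S: "finite S" "S \<subseteq> G" "G \<subseteq> (\<Union>g\<in>S. ?B g)"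
    using finite_subset_image[of \<F> ?B G] by metis
  obtain M :: nat and g where S': "S = g ` {i. i < M}"
    using finite_imp_nat_seg_image_inj_on[OF S(1)] by blast
  let ?V = "\<Union>c<M. ?B (g c)"
  have gM: "g c \<in> carrier U" if "c < M" for c using that S' S(2) G by auto
  have 1: "openin T ?V" using opn S' S(2) by (intro openin_Union) auto
  have 2: "G \<subseteq> ?V" using S(3) S' by (auto simp: lessThan_def)
  have 3: "?V \<subseteq> carrier U" using openin_subset[OF 1] topspace_eq by simp
  have "compactin T K" if K: "lie_subgroup U T A K" "K \<subseteq> ?V" for K
  proof -
    have sub: "subgroup K U" using K(1) by (simp add: lie_subgroup_def)
    obtain W where "openin T W" "\<one>\<^bsub>U\<^esub> \<in> W" "closedin (subtopology T W) (W \<inter> K)"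
      using lie_subgroup_locally_closed[OF K(1)] .
    then show ?thesis using locally_closed_subgroup_compact[OF sub gM K(2)] by blast
  qed
  then have 4: "\<forall>K. lie_subgroup U T A K \<and> K \<subseteq> ?V \<longrightarrow> compactin T K" by blast
  show ?thesis by (intro exI[of _ ?V] conjI 1 2 3 4 order_refl)
qed

end
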